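(* Let $n,r\ge 1$, let $X\in\mathbb{R}^{n\times n}$ be symmetric, let $E\subseteq [n]\times[n]$, and let $\lambda>0$. Consider the regularized problem $$\min_{U,V\in\mathbb{R}^{n\times r}} f(U,V)=\tfrac12\|\mathcal{P}_E(X-UV^T)\|_F^2+\tfrac{\lambda}{2}\|U-V\|_F^2\quad\text{s.t. } U\ge 0,\ V\ge 0, \tag{A}$$ and the symmetric problem $$\min_{U\in\mathbb{R}^{n\times r}} \tfrac12\|\mathcal{P}_E(X-UU^T)\|_F^2\quad\text{s.t. } U\ge 0. \tag{S}$$ Suppose $(U^*,V^* )$ is a critical point of (A) satisfying $$\|\mathcal{P}_E(U^*V^{*T})\|_F<2\lambda+\sigma_n(\mathcal{P}_E(X)),$$ where $\sigma_n(\cdot)$ denotes the $n$-th largest eigenvalue. Then $U^*=V^*$, and $U^*$ is a critical point of (S).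
   Context: $E$ is the index set of the observed entries of the symmetric matrix $X$. The masking operator $\mathcal{P}_E:\mathbb{R}^{n\times n}\to\mathbb{R}^{n\times n}$ is defined by $[\mathcal{P}_E(Y)]_{ij}=Y_{ij}$ if $(i,j)\in E$ and $0$ otherwise. $U\ge 0$ means entrywise nonnegative; $\|\cdot\|_F$ is the Frobenius norm. For $U\ge 0$ let $\partial\delta_+(U)=\{G\in\mathbb{R}^{n\times r}: G\circ U=0,\ G\le 0\}$ ($\circ$ is the entrywise product), and $\partial\delta_+(U)=\emptyset$ if $U\not\ge 0$. A pair $(U,V)$ is a critical point of (A) if $0\in \mathcal{P}_E(UV^T-X)V+\lambda(U-V)+\partial\delta_+(U)$ and $0\in \mathcal{P}_E(UV^T-X)^TU-\lambda(U-V)+\partial\delta_+(V)$. A matrix $U$ is a critical point of (S) if $0\in\mathcal{P}_E(UU^T-X)U+\partial\delta_+(U)$.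
   Formalization: The index set E is additionally assumed symmetric ((i,j) in E iff (j,i) in E); for non-symmetric E the claim can fail, e.g. n=2, r=1, λ=1, E={(1,1),(1,2),(2,2)}, X=(61/64)I, U=(3/4,15/16), V=(15/16,3/4). *)

theory Defs
  imports
    "HOL-Analysis.Analysis"
    "HOL-Computational_Algebra.Computational_Algebra"
begin

definition mask_entries :: "('n::finite \<times> 'n) set \<Rightarrow> real^'n^'n \<Rightarrow> real^'n^'n" where
  "mask_entries E Y = (\<chi> i j. if (i, j) \<in> E then Y $ i $ j else 0)"

definition frob_norm :: "real^'m::finite^'n::finite \<Rightarrow> real" where
  "frob_norm A = sqrt (\<Sum>i\<in>UNIV. \<Sum>j\<in>UNIV. (A $ i $ j)\<^sup>2)"

lemma frob_norm_eq_norm: "frob_norm A = norm A"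
  by (simp add: frob_norm_def norm_vec_def L2_set_def sum_nonneg)

definition charpoly :: "real^'n::finite^'n \<Rightarrow> real poly" where
  "charpoly A = det (\<chi> i j. (if i = j then [:0, 1:] else 0) - [:A $ i $ j:])"

text \<open>The eigenvalues are listed with algebraic multiplicity, in decreasing order, and
  \<open>k\<close> counts from 1. Only real roots of the characteristic polynomial are listed, so for
  \<open>1 \<le> k \<le> CARD('n)\<close> the value is meaningful when all the roots are real, in particular when
  \<open>A\<close> is symmetric.\<close>

definition kth_largest_eigenvalue :: "nat \<Rightarrow> real^'n::finite^'n \<Rightarrow> real" where
  "kth_largest_eigenvalue k A = rev (sorted_list_of_multiset (proots (charpoly A))) ! (k - 1)"

definition nonneg_mat :: "real^'r::finite^'n::finite \<Rightarrow> bool" where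
  "nonneg_mat U \<longleftrightarrow> (\<forall>i j. 0 \<le> U $ i $ j)"

definition subdiff_nonneg :: "real^'r::finite^'n::finite \<Rightarrow> (real^'r^'n) set" where
  "subdiff_nonneg U =
    (if nonneg_mat U then {G. \<forall>i j. G $ i $ j * U $ i $ j = 0 \<and> G $ i $ j \<le> 0} else {})"

definition critical_point_A ::
  "('n::finite \<times> 'n) set \<Rightarrow> real^'n^'n \<Rightarrow> real \<Rightarrow> real^'r::finite^'n \<Rightarrow> real^'r^'n \<Rightarrow> bool" where
  "critical_point_A E X l U V \<longleftrightarrow>
     0 \<in> (\<lambda>G. mask_entries E (U ** transpose V - X) ** V + l *\<^sub>R (U - V) + G) ` subdiff_nonneg U \<and>
     0 \<in> (\<lambda>H. transpose (mask_entries E (U ** transpose V - X)) ** U - l *\<^sub>R (U - V) + H) ` subdiff_nonneg V"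

text \<open>For symmetric \<open>E\<close> and \<open>X\<close> the gradient of half the squared Frobenius norm of
  \<open>mask_entries E (X - U ** transpose U)\<close> is twice the term below; the factor is absorbed by the
  cone \<open>subdiff_nonneg U\<close>.\<close>

definition critical_point_S ::
  "('n::finite \<times> 'n) set \<Rightarrow> real^'n^'n \<Rightarrow> real^'r::finite^'n \<Rightarrow> bool" where
  "critical_point_S E X U \<longleftrightarrow>
     0 \<in> (\<lambda>G. mask_entries E (U ** transpose U - X) ** U + G) ` subdiff_nonneg U"

end

theory Submission
  imports Defs
begin

text \<open>Put \<open>D = U - V\<close>, \<open>P = U V\<^sup>T\<close>, and let \<open>R\<close>, \<open>Z\<close>, \<open>W\<close> be the masked versions of
  \<open>P - X\<close>, \<open>P\<close>, \<open>X\<close>. Pairing the difference of the two stationarity conditions with \<open>D\<close>, the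
  multipliers contribute with a favourable sign, and what remains is
  \<open>2 \<lambda> |D|\<^sup>2 - \<langle>R D, D\<rangle> + \<langle>R, P - P\<^sup>T\<rangle> \<le> 0\<close>. Symmetry of the mask and of \<open>X\<close> turns the last term into
  \<open>|Z|\<^sup>2 - \<langle>Z, Z\<^sup>T\<rangle>\<close>, which is nonnegative. As \<open>\<langle>R D, D\<rangle> \<le> (|Z| - \<sigma>\<^sub>n(W)) |D|\<^sup>2\<close>, the hypothesis
  forces \<open>D = 0\<close>. The bound by \<open>\<sigma>\<^sub>n\<close> needs that the characteristic polynomial of a symmetric matrix
  has \<open>n\<close> real roots (otherwise the list index in the definition of the eigenvalue is out of range)
  and that the minimum of the quadratic form on the unit sphere is one of them.\<close>

section \<open>Determinants, kernels and elementary matrix identities\<close>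

text \<open>The Leibniz formula involves only sums, products and signs, all preserved by
  \<open>h\<close>. It is used with \<open>h\<close> being evaluation of polynomials at a real or a
  complex point.\<close>

lemma det_hom:
  fixes h :: "'a::comm_ring_1 \<Rightarrow> 'b::comm_ring_1" and A :: "'a^'n^'n"
  assumes one: "h 1 = 1"
    and add: "\<And>x y. h (x + y) = h x + h y"
    and mult: "\<And>x y. h (x * y) = h x * h y"
  shows "h (det A) = det (\<chi> i j. h (A $ i $ j))"
proof -
  have zero: "h 0 = 0"
    using add[of 0 0] by simp
  have minus: "h (- x) = - h x" for x
    using add[of x "- x"] zero by (simp add: eq_neg_iff_add_eq_0 add.commute)
  have hsum: "h (sum f S) = (\<Sum>x\<in>S. h (f x))" for f and S :: "('n \<Rightarrow> 'n) set"
    by (induction S rule: infinite_finite_induct) (simp_all add: zero add)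
  have hprod: "h (prod f S) = (\<Prod>x\<in>S. h (f x))" for f and S :: "'n set"
    by (induction S rule: infinite_finite_induct) (simp_all add: one mult)
  have "h (of_int (sign p)) = of_int (sign p)" for p :: "'n \<Rightarrow> 'n"
    by (simp add: sign_def one minus)
  then show ?thesis
    by (simp add: det_def hsum hprod mult)
qed

text \<open>Stated over a general field because both real and complex eigenvectors are extracted
  with it.\<close>

lemma det_eq_0_iff_ker:
  fixes A :: "'a::field^'n^'n"
  shows "det A = 0 \<longleftrightarrow> (\<exists>x. x \<noteq> 0 \<and> A *v x = 0)"
  using invertible_det_nz[of A] invertible_left_inverse[of A] matrix_left_invertible_ker[of A]
  by blast

lemma mat_mult_vec:
  fixes x :: "'a::comm_semiring_1^'n"
  shows "mat c *v x = c *s x"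
  by (simp add: vec_eq_iff matrix_vector_mult_def mat_def if_distrib if_distribR cong: if_cong)

lemma matrix_mult_diff_left:
  fixes A :: "'a::ring_1^'m^'n"
  shows "(A - B) ** C = A ** C - B ** C"
  by (simp add: matrix_matrix_mult_def vec_eq_iff left_diff_distrib sum_subtractf)

lemma matrix_mult_diff_right:
  fixes A :: "'a::ring_1^'m^'n"
  shows "A ** (B - C) = A ** B - A ** C"
  by (simp add: matrix_matrix_mult_def vec_eq_iff right_diff_distrib sum_subtractf)

section \<open>The characteristic polynomial and its real roots\<close>

lemma poly_charpoly: "poly (charpoly A) x = det (mat x - A)"
  unfolding charpoly_def
  by (subst det_hom[where h = "\<lambda>p. poly p x"])
    (auto intro!: arg_cong[where f = det] simp: vec_eq_iff mat_def)

lemma map_poly_of_real_add: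
  "map_poly of_real (p + q) = map_poly of_real p + map_poly of_real q"
  by (rule poly_eqI) (simp add: coeff_map_poly)

lemma map_poly_of_real_mult:
  "map_poly of_real (p * q) =
    (map_poly of_real p * map_poly of_real q :: 'a::{real_algebra_1,comm_ring_1} poly)"
  by (rule poly_eqI) (simp add: coeff_map_poly coeff_mult)

lemma poly_map_poly_of_real:
  "poly (map_poly of_real p) (of_real x) = (of_real (poly p x) :: 'a::{real_algebra_1,comm_ring_1})"
  by (induction p) (simp_all add: map_poly_pCons)

lemma poly_charpoly_complex:
  fixes A :: "real^'n^'n"
  shows "poly (map_poly of_real (charpoly A)) z = det (mat z - (\<chi> i j. complex_of_real (A $ i $ j)))"
  unfolding charpoly_def
  by (subst det_hom[where h = "\<lambda>p. poly (map_poly of_real p) z"])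
    (auto intro!: arg_cong[where f = det]
      simp: vec_eq_iff mat_def map_poly_of_real_add map_poly_of_real_mult map_poly_pCons)

text \<open>In the Leibniz expansion every factor has degree at most 1, and a permutation other than
  \<open>id\<close> moves some \<open>k\<close>, whose factor is constant. So only \<open>id\<close>
  reaches degree \<open>CARD('n)\<close>.\<close>

lemma degree_charpoly:
  fixes A :: "real^'n^'n"
  shows "degree (charpoly A) = CARD('n)"
proof -
  define M where "M = (\<chi> i j. (if i = j then [:0, 1:] else 0) - [:A $ i $ j:])"
  define t where "t p = of_int (sign p) * (\<Prod>i\<in>UNIV. M $ i $ p i)" for p
  have M_diag: "M $ i $ i = [:- A $ i $ i, 1:]" for i
    by (simp add: M_def)
  have t_id: "degree (t id) = CARD('n)"
    by (simp add: t_def M_diag degree_prod_eq_sum_degree)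
  have t_less: "degree (t p) < CARD('n)" if "p \<noteq> id" for p
  proof -
    from that obtain k where k: "k \<noteq> p k"
      by (metis eq_id_iff)
    have "degree (t p) = degree (\<Prod>i\<in>UNIV. M $ i $ p i)"
      by (simp add: t_def sign_def)
    also have "\<dots> \<le> (\<Sum>i\<in>UNIV. degree (M $ i $ p i))"
      using degree_prod_sum_le[of UNIV "\<lambda>i. M $ i $ p i"] by (simp add: o_def)
    also have "\<dots> < (\<Sum>i\<in>(UNIV::'n set). 1)"
      by (rule sum_strict_mono_ex1) (use k in \<open>auto simp: M_def intro!: bexI[of _ k]\<close>)
    finally show ?thesis by simp
  qed
  have "charpoly A = (\<Sum>p\<in>{p. p permutes (UNIV::'n set)}. t p)"
    by (simp add: charpoly_def det_def t_def M_def)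
  also have "\<dots> = t id + (\<Sum>p\<in>{p. p permutes (UNIV::'n set)} - {id}. t p)"
    by (rule sum.remove) (auto simp: permutes_id finite_permutations)
  also have "degree \<dots> = CARD('n)"
    using t_id t_less by (subst degree_add_eq_left) (auto intro!: degree_sum_less)
  finally show ?thesis .
qed

text \<open>Real roots are split off with their multiplicities. What remains has no real root, hence
  by the assumption no complex root, and so is constant.\<close>

lemma size_proots_real_rooted:
  fixes p :: "real poly"
  assumes "\<And>z::complex. poly (map_poly of_real p) z = 0 \<Longrightarrow> z \<in> \<real>"
  shows "size (proots p) = degree p"
  using assms
proof (induction p rule: poly_root_order_induct)
  case 0
  then show ?case by simp
next
  case (no_roots p)
  have "degree p = 0"
  proof (rule ccontr)
    assume "degree p \<noteq> 0"
    then have "degree (map_poly complex_of_real p) > 0"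
      by (simp add: degree_map_poly)
    then obtain z where z: "poly (map_poly complex_of_real p) z = 0"
      using alg_closed_imp_poly_has_root by blast
    then obtain x where "z = of_real x"
      using no_roots.prems Reals_cases by metis
    with z no_roots.hyps show False
      by (simp add: poly_map_poly_of_real)
  qed
  then show ?case
    by (metis degree_eq_zeroE proots_const size_empty)
next
  case (root p x n)
  have "p \<noteq> 0"
    using root.hyps by auto
  moreover have "size (proots p) = degree p"
    using root.prems by (intro root.IH) (simp add: map_poly_of_real_mult)
  ultimately show ?case
    by (simp add: proots_mult proots_power degree_mult_eq degree_power_eq)
qed


text \<open>For a complex eigenvector \<open>v\<close>, the Hermitian form \<open>q\<close> is its
  own conjugate by symmetry of \<open>A\<close>, and it equals \<open>z\<close> times the nonzero
  real number \<open>s\<close>.\<close>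

lemma complex_eigenvalue_of_symmetric_real:
  fixes A :: "real^'n^'n"
  assumes sym: "transpose A = A"
    and root: "poly (map_poly of_real (charpoly A)) (z::complex) = 0"
  shows "z \<in> \<real>"
proof -
  let ?C = "(\<chi> i j. complex_of_real (A $ i $ j)) :: complex^'n^'n"
  obtain v where v: "v \<noteq> 0" "(mat z - ?C) *v v = 0"
    using root unfolding poly_charpoly_complex det_eq_0_iff_ker by blast
  have eig: "(\<Sum>j\<in>UNIV. of_real (A $ i $ j) * v $ j) = z * v $ i" for i
  proof -
    have "((mat z - ?C) *v v) $ i = z * v $ i - (\<Sum>j\<in>UNIV. of_real (A $ i $ j) * v $ j)"
      by (simp add: matrix_vector_mult_diff_rdistrib mat_mult_vec)
        (simp add: matrix_vector_mult_def)
    with v(2) show ?thesis by simp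
  qed
  have A_sym: "A $ j $ i = A $ i $ j" for i j
    using sym by (metis transpose_def vec_lambda_beta)
  define q where "q = (\<Sum>i\<in>UNIV. cnj (v $ i) * (\<Sum>j\<in>UNIV. of_real (A $ i $ j) * v $ j))"
  define s where "s = (\<Sum>i\<in>UNIV. (cmod (v $ i))\<^sup>2)"
  have "cnj q = (\<Sum>i\<in>UNIV. \<Sum>j\<in>UNIV. v $ i * of_real (A $ i $ j) * cnj (v $ j))"
    by (simp add: q_def sum_distrib_left mult_ac)
  also have "\<dots> = (\<Sum>j\<in>UNIV. \<Sum>i\<in>UNIV. v $ i * of_real (A $ i $ j) * cnj (v $ j))"
    by (rule sum.swap)
  also have "\<dots> = q"
    by (simp add: q_def sum_distrib_left mult_ac A_sym)
  finally have "q \<in> \<real>"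
    by (simp add: Reals_cnj_iff)
  moreover have "q = z * of_real s"
    unfolding q_def eig
    by (simp add: s_def sum_distrib_left complex_norm_square mult_ac del: of_real_power)
  moreover have "s \<noteq> 0"
    using v(1) by (auto simp: s_def sum_nonneg_eq_0_iff vec_eq_iff)
  ultimately show ?thesis
    by (metis Reals_divide Reals_of_real nonzero_mult_div_cancel_right of_real_eq_0_iff)
qed

section \<open>The smallest eigenvalue and the quadratic form\<close>

text \<open>Since the ascending list \<open>L\<close> has length \<open>CARD('n)\<close>, position
  \<open>CARD('n) - 1\<close> of its reversal is \<open>L ! 0\<close>, the least root.\<close>

lemma kth_largest_eigenvalue_CARD_le:
  fixes A :: "real^'n^'n"
  assumes "transpose A = A" and "poly (charpoly A) m = 0"
  shows "kth_largest_eigenvalue CARD('n) A \<le> m"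
proof -
  define L where "L = sorted_list_of_multiset (proots (charpoly A))"
  have len: "length L = CARD('n)"
    using complex_eigenvalue_of_symmetric_real[OF assms(1)]
    by (metis L_def degree_charpoly mset_sorted_list_of_multiset size_mset size_proots_real_rooted)
  have "charpoly A \<noteq> 0"
    using degree_charpoly[of A] by auto
  then have "m \<in> set L"
    using assms(2) by (simp add: L_def)
  then have "L ! 0 \<le> m"
    by (metis L_def gr_zeroI in_set_conv_nth sorted_nth_mono sorted_sorted_list_of_multiset zero_le)
  then show ?thesis
    using len by (simp add: kth_largest_eigenvalue_def L_def[symmetric] rev_nth)
qed

text \<open>At \<open>x\<close> the form attains its minimum 0. Moving from \<open>x\<close> by
  \<open>t *\<^sub>R y\<close> with \<open>y = B *v x\<close> changes it to first order by
  \<open>2 * t * (y \<bullet> y)\<close>, so a small negative \<open>t\<close> would make it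
  negative unless \<open>y = 0\<close>.\<close>

lemma psd_isotropic_imp_ker:
  fixes B :: "real^'n^'n"
  assumes sym: "transpose B = B"
    and psd: "\<And>x. 0 \<le> x \<bullet> (B *v x)"
    and x: "x \<bullet> (B *v x) = 0"
  shows "B *v x = 0"
proof -
  define y where "y = B *v x"
  have xy: "x \<bullet> (B *v y) = y \<bullet> y"
    by (metis dot_lmul_matrix sym transpose_matrix_vector y_def)
  have ineq: "0 \<le> t * (2 * (y \<bullet> y) + t * (y \<bullet> (B *v y)))" for t
  proof -
    have "(x + t *\<^sub>R y) \<bullet> (B *v (x + t *\<^sub>R y)) = t * (2 * (y \<bullet> y) + t * (y \<bullet> (B *v y)))"
      using x xy by (simp add: matrix_vector_right_distrib matrix_vector_mult_scaleR inner_simps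
          y_def[symmetric] algebra_simps)
    with psd[of "x + t *\<^sub>R y"] show ?thesis by simp
  qed
  have "y \<bullet> y = 0"
  proof (rule ccontr)
    assume "y \<bullet> y \<noteq> 0"
    define c where "c = y \<bullet> (B *v y)"
    have yy: "y \<bullet> y > 0"
      using \<open>y \<bullet> y \<noteq> 0\<close> by (simp add: less_le)
    have c: "c \<ge> 0"
      using psd by (simp add: c_def)
    \<comment> \<open>Chosen so that \<open>t * c\<close> is at least
      \<open>- (y \<bullet> y)\<close>, which keeps the bracket positive; the \<open>+ 1\<close>
      covers \<open>c = 0\<close>.\<close>
    define t where "t = - (y \<bullet> y) / (c + 1)"
    have "t < 0" "- (y \<bullet> y) \<le> t * c"
      using yy c by (simp_all add: t_def field_simps)
    then have "t * (2 * (y \<bullet> y) + t * c) < 0"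
      using yy by (intro mult_neg_pos) linarith+
    with ineq[of t] show False
      by (simp add: c_def)
  qed
  then show ?thesis
    by (simp add: y_def)
qed

text \<open>The minimum \<open>m\<close> of the form on the compact unit sphere is an eigenvalue:
  \<open>A - mat m\<close> is positive semidefinite and its form vanishes at the minimiser
  \<open>u\<close>, so \<open>u\<close> lies in its kernel.\<close>

lemma kth_largest_eigenvalue_CARD_quadratic_form:
  fixes A :: "real^'n^'n"
  assumes sym: "transpose A = A"
  shows "kth_largest_eigenvalue CARD('n) A * (x \<bullet> x) \<le> x \<bullet> (A *v x)"
proof -
  have "continuous_on (sphere 0 1) (\<lambda>x. x \<bullet> (A *v x))"
    by (intro continuous_intros)
  moreover have "sphere (0::real^'n) 1 \<noteq> {}"
    using vector_choose_size[of 1] by (auto simp: sphere_def)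
  ultimately obtain u where u: "u \<in> sphere 0 1"
    and u_min: "\<And>y. y \<in> sphere 0 1 \<Longrightarrow> u \<bullet> (A *v u) \<le> y \<bullet> (A *v y)"
    using continuous_attains_inf[of "sphere (0::real^'n) 1" "\<lambda>x. x \<bullet> (A *v x)"] by auto
  define m where "m = u \<bullet> (A *v u)"
  have m_le: "m * (y \<bullet> y) \<le> y \<bullet> (A *v y)" for y
  proof (cases "y = 0")
    case False
    have "m \<le> (y /\<^sub>R norm y) \<bullet> (A *v (y /\<^sub>R norm y))"
      unfolding m_def by (rule u_min) (use False in simp)
    also have "\<dots> = (y \<bullet> (A *v y)) / (y \<bullet> y)"
      by (simp add: matrix_vector_mult_scaleR dot_square_norm power2_eq_square divide_simps)
    finally show ?thesis
      using False by (simp add: field_simps)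
  qed simp
  define B where "B = A - mat m"
  have Bv: "B *v y = A *v y - m *\<^sub>R y" for y
    by (simp add: B_def matrix_vector_mult_diff_rdistrib mat_mult_vec scalar_mult_eq_scaleR)
  have "B *v u = 0"
  proof (rule psd_isotropic_imp_ker)
    show "transpose B = B"
      using sym by (simp add: B_def transpose_def vec_eq_iff mat_def)
    show "0 \<le> y \<bullet> (B *v y)" for y
      using m_le[of y] by (simp add: Bv inner_diff_right)
    show "u \<bullet> (B *v u) = 0"
      using u by (simp add: Bv inner_diff_right m_def dot_square_norm)
  qed
  then have "(mat m - A) *v u = 0"
    by (simp add: B_def matrix_vector_mult_diff_rdistrib)
  moreover have "u \<noteq> 0"
    using u by auto
  ultimately have "poly (charpoly A) m = 0"
    unfolding poly_charpoly det_eq_0_iff_ker by blast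
  then have "kth_largest_eigenvalue CARD('n) A \<le> m"
    by (rule kth_largest_eigenvalue_CARD_le[OF sym])
  then have "kth_largest_eigenvalue CARD('n) A * (x \<bullet> x) \<le> m * (x \<bullet> x)"
    by (rule mult_right_mono) simp
  with m_le[of x] show ?thesis by linarith
qed

section \<open>The Frobenius inner product and column-wise bounds\<close>

lemma inner_matrix_mult_eq:
  fixes A :: "real^'m^'n" and B :: "real^'k^'m" and C :: "real^'k^'n"
  shows "(A ** B) \<bullet> C = A \<bullet> (C ** transpose B)"
proof -
  have "(A ** B) \<bullet> C = (\<Sum>i\<in>UNIV. \<Sum>k\<in>UNIV. \<Sum>j\<in>UNIV. A $ i $ j * B $ j $ k * C $ i $ k)"
    by (simp add: inner_vec_def matrix_matrix_mult_def sum_distrib_right)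
  also have "\<dots> = (\<Sum>i\<in>UNIV. \<Sum>j\<in>UNIV. \<Sum>k\<in>UNIV. A $ i $ j * B $ j $ k * C $ i $ k)"
    by (intro sum.cong refl sum.swap)
  also have "\<dots> = A \<bullet> (C ** transpose B)"
    by (simp add: inner_vec_def matrix_matrix_mult_def transpose_def sum_distrib_left mult_ac)
  finally show ?thesis .
qed

lemma inner_transpose_transpose:
  fixes A B :: "real^'m^'n"
  shows "transpose A \<bullet> transpose B = A \<bullet> B"
  unfolding inner_vec_def transpose_def by (simp add: sum.swap[of _ "UNIV :: 'n set"])

lemma inner_transpose_left:
  fixes A :: "real^'m^'n" and B :: "real^'n^'m"
  shows "transpose A \<bullet> B = A \<bullet> transpose B"
  by (metis inner_transpose_transpose transpose_transpose)

lemma norm_transpose: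
  fixes A :: "real^'m^'n"
  shows "norm (transpose A) = norm A"
  by (simp add: norm_eq_sqrt_inner inner_transpose_transpose)

text \<open>Reduces bounds on \<open>(A ** D) \<bullet> D\<close> to bounds on the quadratic form of
  \<open>A\<close>, one column at a time.\<close>

lemma inner_matrix_mult_columns:
  fixes A :: "real^'n^'n" and D :: "real^'r^'n"
  shows "(A ** D) \<bullet> D = (\<Sum>k\<in>UNIV. column k D \<bullet> (A *v column k D))"
  unfolding inner_vec_def matrix_matrix_mult_def matrix_vector_mult_def column_def
  by (simp add: mult.commute) (rule sum.swap)

lemma inner_columns:
  fixes D :: "real^'r^'n"
  shows "D \<bullet> D = (\<Sum>k\<in>UNIV. column k D \<bullet> column k D)"
  unfolding inner_vec_def column_def by simp (rule sum.swap)

text \<open>Cauchy-Schwarz in each row; \<open>norm A\<close> is the Frobenius norm here.\<close>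

lemma matrix_vector_mult_norm_le:
  fixes A :: "real^'m^'n"
  shows "norm (A *v x) \<le> norm A * norm x"
proof -
  have "norm (A *v x) = L2_set (\<lambda>i. \<bar>A $ i \<bullet> x\<bar>) UNIV"
    by (simp add: norm_vec_def matrix_mult_dot)
  also have "\<dots> \<le> L2_set (\<lambda>i. norm (A $ i) * norm x) UNIV"
    by (intro L2_set_mono) (auto simp: Cauchy_Schwarz_ineq2)
  also have "\<dots> = norm A * norm x"
    by (simp add: norm_vec_def[of A] L2_set_left_distrib)
  finally show ?thesis .
qed

lemma inner_matrix_mult_le:
  fixes A :: "real^'n^'n" and D :: "real^'r^'n"
  shows "(A ** D) \<bullet> D \<le> norm A * (D \<bullet> D)"
proof -
  have "x \<bullet> (A *v x) \<le> norm A * (x \<bullet> x)" for x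
  proof -
    have "x \<bullet> (A *v x) \<le> norm x * norm (A *v x)"
      by (rule norm_cauchy_schwarz)
    also have "\<dots> \<le> norm x * (norm A * norm x)"
      by (intro mult_left_mono matrix_vector_mult_norm_le) simp
    finally show ?thesis
      by (simp add: dot_square_norm power2_eq_square mult_ac)
  qed
  then show ?thesis
    unfolding inner_matrix_mult_columns inner_columns sum_distrib_left by (intro sum_mono)
qed

lemma kth_largest_eigenvalue_CARD_le_inner:
  fixes A :: "real^'n^'n" and D :: "real^'r^'n"
  assumes "transpose A = A"
  shows "kth_largest_eigenvalue CARD('n) A * (D \<bullet> D) \<le> (A ** D) \<bullet> D"
  unfolding inner_matrix_mult_columns inner_columns sum_distrib_left
  by (intro sum_mono kth_largest_eigenvalue_CARD_quadratic_form assms)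

section \<open>The mask and the multipliers\<close>

lemma mask_entries_diff: "mask_entries E (A - B) = mask_entries E A - mask_entries E B"
  by (simp add: mask_entries_def vec_eq_iff)

lemma transpose_mask_entries:
  assumes "sym E"
  shows "transpose (mask_entries E A) = mask_entries E (transpose A)"
  using assms by (auto simp: mask_entries_def transpose_def vec_eq_iff sym_def)

text \<open>Masking is an orthogonal projection.\<close>

lemma inner_mask_entries: "mask_entries E A \<bullet> B = mask_entries E A \<bullet> mask_entries E B"
  unfolding inner_vec_def mask_entries_def by (intro sum.cong refl) auto

text \<open>Complementarity kills the \<open>U\<close> part, and \<open>G \<le> 0\<close> against
  \<open>V \<ge> 0\<close> entrywise gives the sign of the rest.\<close>

lemma subdiff_nonneg_inner:
  assumes "G \<in> subdiff_nonneg U" and "nonneg_mat V"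
  shows "G \<bullet> (U - V) \<ge> 0"
proof -
  have "G $ i $ j * U $ i $ j = 0" "G $ i $ j * V $ i $ j \<le> 0" for i j
    using assms
    by (simp_all add: subdiff_nonneg_def nonneg_mat_def mult_nonpos_nonneg split: if_splits)
  then have "G $ i $ j * (U - V) $ i $ j \<ge> 0" for i j
    unfolding vector_minus_component right_diff_distrib by (metis diff_0 neg_0_le_iff_le)
  then show ?thesis
    by (simp add: inner_vec_def sum_nonneg)
qed

theorem theorem1:
  fixes X :: "real^'n::finite^'n"
    and E :: "('n \<times> 'n) set"
    and l :: real
    and U V :: "real^'r::finite^'n"
  assumes "transpose X = X"
    and "sym E"
    and "l > 0"
    and "critical_point_A E X l U V"
    and "frob_norm (mask_entries E (U ** transpose V))
           < 2 * l + kth_largest_eigenvalue CARD('n) (mask_entries E X)"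
  shows "U = V \<and> critical_point_S E X U"
proof -
  define P where "P = U ** transpose V"
  define Z where "Z = mask_entries E P"
  define W where "W = mask_entries E X"
  define R where "R = Z - W"
  define D where "D = U - V"
  have R: "mask_entries E (U ** transpose V - X) = R"
    by (simp add: R_def Z_def W_def P_def mask_entries_diff)
  obtain G H where G: "G \<in> subdiff_nonneg U" "R ** V + l *\<^sub>R D + G = 0"
    and H: "H \<in> subdiff_nonneg V" "transpose R ** U - l *\<^sub>R D + H = 0"
    using assms(4) unfolding critical_point_A_def R D_def by (auto simp: image_iff)
  have "nonneg_mat U" "nonneg_mat V"
    using G(1) H(1) by (auto simp: subdiff_nonneg_def split: if_splits)
  then have "G \<bullet> D \<ge> 0" "H \<bullet> D \<le> 0"
    using subdiff_nonneg_inner[OF G(1), of V] subdiff_nonneg_inner[OF H(1), of U]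
    by (simp_all add: D_def inner_diff_right)
  moreover have "(R ** V) \<bullet> D + l * (D \<bullet> D) + G \<bullet> D = 0"
    using arg_cong[OF G(2), of "\<lambda>M. M \<bullet> D"] by (simp add: inner_simps)
  moreover have "(transpose R ** U) \<bullet> D - l * (D \<bullet> D) + H \<bullet> D = 0"
    using arg_cong[OF H(2), of "\<lambda>M. M \<bullet> D"] by (simp add: inner_simps)
  ultimately have stationary:
    "(R ** V) \<bullet> D - (transpose R ** U) \<bullet> D + 2 * l * (D \<bullet> D) \<le> 0"
    by linarith
  have tr_inner: "(transpose R ** A) \<bullet> B = (R ** B) \<bullet> A" for A B :: "real^'r^'n"
    by (simp add: inner_matrix_mult_eq inner_transpose_left matrix_transpose_mul)
  have tr_P: "V ** transpose U = transpose P"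
    by (simp add: P_def matrix_transpose_mul)
  \<comment> \<open>Both sides expand to \<open>2 * ((R ** V) \<bullet> U) - (R ** U) \<bullet> U -
    (R ** V) \<bullet> V\<close>.\<close>
  have split: "(R ** V) \<bullet> D - (transpose R ** U) \<bullet> D =
      R \<bullet> P - R \<bullet> transpose P - (R ** D) \<bullet> D"
  proof -
    have "(R ** V) \<bullet> U = R \<bullet> P" "(R ** U) \<bullet> V = R \<bullet> transpose P"
      by (simp_all add: inner_matrix_mult_eq P_def matrix_transpose_mul)
    then show ?thesis
      by (simp add: D_def tr_inner inner_simps matrix_mult_diff_right)
  qed
  have W_sym: "transpose W = W"
    using assms(1,2) by (simp add: W_def transpose_mask_entries)
  have "R \<bullet> P - R \<bullet> transpose P = Z \<bullet> Z - Z \<bullet> transpose Z"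
  proof -
    \<comment> \<open>The symmetric \<open>W\<close> is orthogonal to the antisymmetric
      \<open>P - transpose P\<close>, so the data drop out of this term.\<close>
    have "W \<bullet> transpose P = W \<bullet> P"
      using inner_transpose_left[of W P] W_sym by simp
    moreover have "Z \<bullet> P = Z \<bullet> Z" "Z \<bullet> transpose P = Z \<bullet> transpose Z"
      using assms(2) unfolding Z_def by (metis inner_mask_entries transpose_mask_entries)+
    ultimately show ?thesis
      by (simp add: R_def inner_diff_left)
  qed
  moreover have "Z \<bullet> transpose Z \<le> Z \<bullet> Z"
    using norm_cauchy_schwarz[of Z "transpose Z"]
    by (simp add: norm_transpose dot_square_norm power2_eq_square)
  ultimately have "2 * l * (D \<bullet> D) \<le> (R ** D) \<bullet> D"
    using stationary split by linarith
  also have "\<dots> = (Z ** D) \<bullet> D - (W ** D) \<bullet> D"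
    by (simp add: R_def matrix_mult_diff_left inner_diff_left)
  also have "\<dots> \<le> norm Z * (D \<bullet> D) - kth_largest_eigenvalue CARD('n) W * (D \<bullet> D)"
    using inner_matrix_mult_le kth_largest_eigenvalue_CARD_le_inner[OF W_sym] by (rule diff_mono)
  finally have "(2 * l + kth_largest_eigenvalue CARD('n) W - norm Z) * (D \<bullet> D) \<le> 0"
    by (simp add: algebra_simps)
  moreover have "2 * l + kth_largest_eigenvalue CARD('n) W - norm Z > 0"
    using assms(5) by (simp add: W_def Z_def P_def frob_norm_eq_norm)
  ultimately have "D \<bullet> D \<le> 0"
    by (simp add: mult_le_0_iff)
  then have "D = 0"
    by (metis inner_ge_zero inner_eq_zero_iff order_antisym)
  then have "U = V"
    by (simp add: D_def)
  \<comment> \<open>With \<open>D = 0\<close> the regularizing term vanishes, and the multiplier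
    \<open>G\<close> of the first condition serves unchanged.\<close>
  moreover have "critical_point_S E X U"
    using G \<open>D = 0\<close> R \<open>U = V\<close> unfolding critical_point_S_def
    by (auto simp: image_iff intro!: bexI[of _ G])
  ultimately show ?thesis
    by simp
qed

end
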